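(* Let $G=\mathbb{F}_p^n$, let $k,t$ be positive integers with $t\geq 20k$ and let $B\subset G^2$ be a bilinear Bohr set of codimension $k$ and rank $t$. Then every function $\phi:B\to G$ that is affine in each variable separately can be extended to a function defined on all of $G^2$ that is affine in each variable separately.
   Context: $p$ is a prime. A bi-affine map $\beta:G^2\to\mathbb{F}_p^k$ is a map affine in each variable separately; its coordinates have the form $\beta_i(x,y)=x\cdot T_iy+x\cdot a_i+b_i\cdot y+\lambda_i$ with $T_i$ linear, and its rank is the minimum over non-zero $u\in\mathbb{F}_p^k$ of the rank of $\sum_iu_iT_i$. A bilinear Bohr set of codimension $k$ is a set $\{(x,y)\in G^2:\beta(x,y)=z\}$ with $\beta:G^2\to\mathbb{F}_p^k$ bi-affine and $z\in\mathbb{F}_p^k$; its rank is the highest rank of a bi-affine map of which it is such a level set. A function $\phi$ on $B$ is affine in each variable separately if for each $x$ the map $y\mapsto\phi(x,y)$ on $\{y:(x,y)\in B\}$ is the restriction of an affine map, and for each $y$ the map $x\mapsto\phi(x,y)$ on $\{x:(x,y)\in B\}$ is the restriction of an affine map. *)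

theory Defs
  imports "HOL-Analysis.Analysis" "Berlekamp_Zassenhaus.Finite_Field"
begin

text \<open>
  The field with \<open>p\<close> elements is \<open>'p mod_ring\<close> with \<open>'p :: prime_card\<close> (so \<open>p = CARD('p)\<close>), and
  \<open>\<bbbF>\<^sub>p\<^sup>n\<close> is \<open>'p mod_ring ^ 'n\<close>.
\<close>

definition dot :: "'p::prime_card mod_ring ^ 'n \<Rightarrow> 'p mod_ring ^ 'n \<Rightarrow> 'p mod_ring"
  where "dot x y = (\<Sum>j\<in>UNIV. x $ j * y $ j)"

definition affine_map :: "('p::prime_card mod_ring ^ 'n \<Rightarrow> 'p mod_ring ^ 'm) \<Rightarrow> bool"
  where "affine_map f \<longleftrightarrow> (\<exists>L c. Vector_Spaces.linear (*s) (*s) L \<and> (\<forall>x. f x = L x + c))"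

text \<open>Only the values of \<open>\<phi>\<close> on \<open>B\<close> matter: \<open>\<phi>\<close> stands for a function defined on \<open>B\<close>.\<close>

definition separately_affine_on ::
    "(('p::prime_card mod_ring ^ 'n) \<times> ('p mod_ring ^ 'n)) set
      \<Rightarrow> (('p mod_ring ^ 'n) \<times> ('p mod_ring ^ 'n) \<Rightarrow> 'p mod_ring ^ 'm) \<Rightarrow> bool"
  where "separately_affine_on B \<phi> \<longleftrightarrow>
    (\<forall>x. \<exists>f. affine_map f \<and> (\<forall>y. (x, y) \<in> B \<longrightarrow> \<phi> (x, y) = f y)) \<and>
    (\<forall>y. \<exists>f. affine_map f \<and> (\<forall>x. (x, y) \<in> B \<longrightarrow> \<phi> (x, y) = f x))"

abbreviation bi_affine ::
    "(('p::prime_card mod_ring ^ 'n) \<times> ('p mod_ring ^ 'n) \<Rightarrow> 'p mod_ring ^ 'k) \<Rightarrow> bool"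
  where "bi_affine \<equiv> separately_affine_on UNIV"

definition has_bilinear_part ::
    "(('p::prime_card mod_ring ^ 'n) \<times> ('p mod_ring ^ 'n) \<Rightarrow> 'p mod_ring ^ 'k)
      \<Rightarrow> ('k \<Rightarrow> 'p mod_ring ^ 'n \<Rightarrow> 'p mod_ring ^ 'n) \<Rightarrow> bool"
  where "has_bilinear_part \<beta> T \<longleftrightarrow>
    (\<forall>i. Vector_Spaces.linear (*s) (*s) (T i) \<and>
      (\<exists>a b l. \<forall>x y. \<beta> (x, y) $ i = dot x (T i y) + dot x a + dot b y + l))"

text \<open>For bi-affine \<open>\<beta>\<close> the maps \<open>T\<^sub>i\<close> exist and are unique, see \<open>ex1_bilinear_part\<close> below.\<close>

definition bilinear_part ::
    "(('p::prime_card mod_ring ^ 'n) \<times> ('p mod_ring ^ 'n) \<Rightarrow> 'p mod_ring ^ 'k)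
      \<Rightarrow> 'k \<Rightarrow> 'p mod_ring ^ 'n \<Rightarrow> 'p mod_ring ^ 'n"
  where "bilinear_part \<beta> = (THE T. has_bilinear_part \<beta> T)"

definition linear_rank :: "('p::prime_card mod_ring ^ 'n \<Rightarrow> 'p mod_ring ^ 'm) \<Rightarrow> nat"
  where "linear_rank L = vec.dim (range L)"

definition bi_affine_rank ::
    "(('p::prime_card mod_ring ^ 'n) \<times> ('p mod_ring ^ 'n) \<Rightarrow> 'p mod_ring ^ 'k) \<Rightarrow> nat"
  where "bi_affine_rank \<beta> =
    Min {linear_rank (\<lambda>y. \<Sum>i\<in>UNIV. u $ i *s bilinear_part \<beta> i y) | u. u \<noteq> 0}"

text \<open>The codimension is \<open>k = CARD('k)\<close>; the type argument records \<open>'k\<close>.\<close>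

definition bilinear_bohr_set ::
    "'k::finite itself \<Rightarrow> (('p::prime_card mod_ring ^ 'n) \<times> ('p mod_ring ^ 'n)) set \<Rightarrow> bool"
  where "bilinear_bohr_set _ B \<longleftrightarrow>
    (\<exists>(\<beta> :: _ \<Rightarrow> 'p mod_ring ^ 'k) z. bi_affine \<beta> \<and> B = {v. \<beta> v = z})"

definition bohr_rank ::
    "'k::finite itself \<Rightarrow> (('p::prime_card mod_ring ^ 'n) \<times> ('p mod_ring ^ 'n)) set \<Rightarrow> nat"
  where "bohr_rank _ B =
    Max {bi_affine_rank \<beta> | (\<beta> :: _ \<Rightarrow> 'p mod_ring ^ 'k) z. bi_affine \<beta> \<and> B = {v. \<beta> v = z}}"

lemma affine_map_component:
  assumes "affine_map f"
  shows "f y $ i = f 0 $ i + (\<Sum>j\<in>UNIV. y $ j * (f (axis j 1) $ i - f 0 $ i))"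
proof -
  obtain L c where L: "Vector_Spaces.linear (*s) (*s) L" and f: "\<And>x. f x = L x + c"
    using assms by (auto simp: affine_map_def)
  interpret L: Vector_Spaces.linear "(*s)" "(*s)" L by fact
  have "L y = L (\<Sum>j\<in>UNIV. y $ j *s axis j 1)"
    by (simp add: basis_expansion)
  also have "\<dots> = (\<Sum>j\<in>UNIV. y $ j *s L (axis j 1))"
    by (simp add: L.sum L.scale)
  finally show ?thesis
    by (simp add: f L.zero)
qed

lemma ex_bilinear_part:
  fixes \<beta> :: "('p::prime_card mod_ring ^ 'n) \<times> ('p mod_ring ^ 'n) \<Rightarrow> 'p mod_ring ^ 'k"
  assumes "bi_affine \<beta>"
  shows "\<exists>T. has_bilinear_part \<beta> T"
proof -
  define D where "D i j y = \<beta> (axis j 1, y) $ i - \<beta> (0, y) $ i" for i j y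
  define T where "T i y = (\<chi> j. D i j y - D i j 0)" for i y
  have X: "\<beta> (x, y) $ i = \<beta> (0, y) $ i + (\<Sum>j\<in>UNIV. x $ j * D i j y)" for x y i
  proof -
    obtain f where "affine_map f" "\<And>x. \<beta> (x, y) = f x"
      using assms unfolding separately_affine_on_def by blast
    with affine_map_component[of f x i] show ?thesis by (simp add: D_def)
  qed
  have Y: "\<exists>f. affine_map f \<and> (\<forall>y. \<beta> (x, y) = f y)" for x
    using assms unfolding separately_affine_on_def by blast
  have "Vector_Spaces.linear (*s) (*s) (T i)" for i
  proof -
    have lin: "\<exists>L. Vector_Spaces.linear (*s) (*s) L \<and> (\<forall>y. \<beta> (x, y) = L y + \<beta> (x, 0))" for x
    proof -
      obtain L c where L: "Vector_Spaces.linear (*s) (*s) L" and f: "\<And>y. \<beta> (x, y) = L y + c"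
        using Y[of x] by (auto simp: affine_map_def)
      interpret L: Vector_Spaces.linear "(*s)" "(*s)" L by fact
      have "\<beta> (x, y) = L y + \<beta> (x, 0)" for y
        by (simp add: f L.zero)
      with L show ?thesis by blast
    qed
    then obtain L where L: "\<And>x. Vector_Spaces.linear (*s) (*s) (L x)"
      and f: "\<And>x y. \<beta> (x, y) = L x y + \<beta> (x, 0)"
      by metis
    have D: "D i j y - D i j 0 = L (axis j 1) y $ i - L 0 y $ i" for j y
      by (simp only: D_def f[of _ y] vector_add_component) (simp add: algebra_simps)
    have T: "T i y = (\<chi> j. L (axis j 1) y $ i - L 0 y $ i)" for y
      by (simp only: T_def D)
    have "vector_space ((*s) :: 'p mod_ring \<Rightarrow> 'p mod_ring ^ 'n \<Rightarrow> _)"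
      using L[of 0] unfolding Vector_Spaces.linear_iff by blast
    moreover have "T i (y + y') = T i y + T i y'" "T i (c *s y) = c *s T i y" for y y' c
      using L unfolding Vector_Spaces.linear_iff by (simp_all add: T vec_eq_iff right_diff_distrib)
    ultimately show ?thesis
      unfolding Vector_Spaces.linear_iff by blast
  qed
  moreover have "\<exists>a b l. \<forall>x y. \<beta> (x, y) $ i = dot x (T i y) + dot x a + dot b y + l" for i
  proof -
    obtain f where f: "affine_map f" "\<And>y. \<beta> (0, y) = f y"
      using Y[of 0] by auto
    define b where "b = (\<chi> j. f (axis j 1) $ i - f 0 $ i)"
    have "\<beta> (x, y) $ i = dot x (T i y) + dot x (\<chi> j. D i j 0) + dot b y + f 0 $ i" for x y
    proof -
      have "dot x (T i y) + dot x (\<chi> j. D i j 0) = (\<Sum>j\<in>UNIV. x $ j * D i j y)"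
        by (simp add: dot_def T_def sum.distrib[symmetric] right_diff_distrib)
      moreover have "dot b y + f 0 $ i = f y $ i"
        by (simp add: affine_map_component[OF f(1), of y i] dot_def b_def mult.commute)
      moreover have "\<beta> (x, y) $ i = f y $ i + (\<Sum>j\<in>UNIV. x $ j * D i j y)"
        using X[of x y i] f(2)[of y] by (simp only:)
      ultimately have "\<beta> (x, y) $ i = dot b y + f 0 $ i + (dot x (T i y) + dot x (\<chi> j. D i j 0))"
        by (simp only:)
      then show ?thesis by (simp only: ac_simps)
    qed
    then show ?thesis by blast
  qed
  ultimately show ?thesis
    unfolding has_bilinear_part_def by blast
qed

lemma has_bilinear_part_component:
  assumes "has_bilinear_part \<beta> T"
  shows "T i y $ j =
    \<beta> (axis j 1, y) $ i - \<beta> (0, y) $ i - \<beta> (axis j 1, 0) $ i + \<beta> (0, 0) $ i"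
proof -
  have lin: "Vector_Spaces.linear (*s) (*s) (T i)"
    using assms by (auto simp: has_bilinear_part_def)
  interpret T: Vector_Spaces.linear "(*s)" "(*s)" "T i" by fact
  obtain a b l where "\<And>x y. \<beta> (x, y) $ i = dot x (T i y) + dot x a + dot b y + l"
    using assms unfolding has_bilinear_part_def by blast
  moreover have "dot (axis j 1) v = v $ j" "dot 0 v = 0" "dot v 0 = 0" for v :: "'a mod_ring ^ 'b"
    by (simp_all add: dot_def axis_def if_distrib[of "\<lambda>c. c * _"] cong: if_cong)
  ultimately show ?thesis
    by (simp add: T.zero)
qed

lemma ex1_bilinear_part: "bi_affine \<beta> \<Longrightarrow> \<exists>!T. has_bilinear_part \<beta> T"
proof (rule ex_ex1I)
  show "T = T'" if "has_bilinear_part \<beta> T" "has_bilinear_part \<beta> T'" for T T'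
    by (intro ext, unfold vec_eq_iff)
      (simp only: has_bilinear_part_component[OF that(1)] has_bilinear_part_component[OF that(2)] simp_thms)
qed (rule ex_bilinear_part)

end

theory Submission
  imports Defs
begin

text \<open>
  Over a prime field a map is affine iff it preserves combinations \<open>x - y + z\<close>, so only the additive
  structure matters outside the counting argument. High rank gives: if \<open>g\<^sub>1, \<dots>, g\<^sub>m\<close> (\<open>m \<le> 3\<close>) are
  affine maps to \<open>\<bbbF>\<^sub>p\<^sup>k\<close> that are jointly onto, then \<open>\<beta> x, g\<^sub>1, \<dots>, g\<^sub>m\<close> are jointly onto for all \<open>x\<close>
  outside a set of density at most \<open>p\<^bsup>-16k\<^esup>\<close>. An affine map vanishing on the common zero set of
  jointly onto maps \<open>g\<^sub>i\<close> has the form \<open>\<Sum>\<^sub>i \<Phi>\<^sub>i \<circ> g\<^sub>i\<close> with additive \<open>\<Phi>\<^sub>i\<close>.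

  For generic \<open>x\<close> an affine extension \<open>F x\<close> of \<open>\<phi> x\<close> from \<open>{\<beta> x = 0}\<close> is unique only up to
  \<open>\<Phi> \<circ> \<beta> x\<close>. The ambiguity is removed by fixing a generic direction \<open>h\<close> and an affine map \<open>\<alpha>\<close> that
  plays the role of the difference of the extensions at \<open>x + h\<close> and \<open>x\<close>, and demanding that
  \<open>F x + \<alpha>\<close> extends \<open>\<phi> (x + h)\<close>. For generic \<open>x\<^sub>4 = x\<^sub>1 - x\<^sub>2 + x\<^sub>3\<close> the defect
  \<open>F x\<^sub>1 - F x\<^sub>2 + F x\<^sub>3 - F x\<^sub>4\<close> then vanishes on the common zero set of \<open>\<beta> x\<^sub>1, \<beta> x\<^sub>2, \<beta> x\<^sub>3\<close> and on
  its variants with some of the \<open>x\<^sub>i\<close> shifted by \<open>h\<close>, which forces it to be \<open>0\<close>. Hence \<open>F\<close> is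
  affine on almost all of \<open>G\<close>, extends to all of \<open>G\<close>, and the extension agrees with \<open>\<phi>\<close> on the
  remaining fibres because their points are combinations of generic ones.
\<close>

section \<open>Additive and affine maps of abelian groups\<close>

definition affine_hom :: "('a::ab_group_add \<Rightarrow> 'b::ab_group_add) \<Rightarrow> bool"
  where "affine_hom f \<longleftrightarrow> (\<forall>x y z. f (x - y + z) = f x - f y + f z)"

lemma affine_homD: "affine_hom f \<Longrightarrow> f (x - y + z) = f x - f y + f z"
  by (simp add: affine_hom_def)

lemma affine_hom_diff: "affine_hom f \<Longrightarrow> affine_hom g \<Longrightarrow> affine_hom (\<lambda>x. f x - g x)"
  by (simp add: affine_hom_def algebra_simps)

lemma affine_hom_add: "affine_hom f \<Longrightarrow> affine_hom g \<Longrightarrow> affine_hom (\<lambda>x. f x + g x)"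
  by (simp add: affine_hom_def)

lemma affine_hom_const: "affine_hom (\<lambda>x. c)"
  by (simp add: affine_hom_def)

lemma affine_hom_additive:
  assumes "Modules.additive \<Phi>" "affine_hom g"
  shows "affine_hom (\<lambda>x. \<Phi> (g x))"
  using assms by (simp add: affine_hom_def Modules.additive.add Modules.additive.diff)

lemma affine_hom_eqI:
  assumes "affine_hom f" "d = a - b + c"
  shows "f a - f b + f c = f d"
  using assms by (simp add: affine_hom_def)

definition jointly_onto :: "('a \<Rightarrow> 'b) list \<Rightarrow> bool"
  where "jointly_onto gs \<longleftrightarrow> (\<forall>ws. length ws = length gs \<longrightarrow> (\<exists>y. map (\<lambda>g. g y) gs = ws))"

lemma jointly_onto_Nil: "jointly_onto []"
  by (simp add: jointly_onto_def)

lemma jointly_onto_Cons: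
  "jointly_onto (g # gs) \<longleftrightarrow>
    (\<forall>w ws. length ws = length gs \<longrightarrow> (\<exists>y. g y = w \<and> map (\<lambda>g. g y) gs = ws))"
  by (auto simp: jointly_onto_def length_Suc_conv)

lemma jointly_onto_tl: "jointly_onto (g # gs) \<Longrightarrow> jointly_onto gs"
proof -
  assume *: "jointly_onto (g # gs)"
  show ?thesis
    unfolding jointly_onto_def
  proof (intro allI impI)
    fix ws :: "'b list"
    assume "length ws = length gs"
    then show "\<exists>y. map (\<lambda>g. g y) gs = ws"
      using * unfolding jointly_onto_Cons by blast
  qed
qed

lemma jointly_onto_2: "jointly_onto [a, b] \<longleftrightarrow> (\<forall>p q. \<exists>y. a y = p \<and> b y = q)"
  by (simp add: jointly_onto_Cons length_Suc_conv) blast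

lemma jointly_onto_3:
  "jointly_onto [a, b, c] \<longleftrightarrow> (\<forall>p q r. \<exists>y. a y = p \<and> b y = q \<and> c y = r)"
  by (simp add: jointly_onto_Cons length_Suc_conv) blast

lemma jointly_onto_4:
  "jointly_onto [a, b, c, d] \<longleftrightarrow>
    (\<forall>p q r s. \<exists>y. a y = p \<and> b y = q \<and> c y = r \<and> d y = s)"
  by (simp add: jointly_onto_Cons length_Suc_conv) blast

text \<open>Two points \<open>y\<close>, \<open>y'\<close> of \<open>P\<close> in one fibre of
  \<open>g\<close> give the point \<open>y - y' + s 0\<close> of the zero fibre, so \<open>D\<close>
  is constant on fibres. \<open>D (s 0) = 0\<close> makes the induced map additive and not merely
  affine. Working inside \<open>P\<close> lets \<open>factor_through\<close> peel off one map at a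
  time.\<close>

lemma factor_through_one:
  fixes g :: "'a::ab_group_add \<Rightarrow> 'b::ab_group_add" and D :: "'a \<Rightarrow> 'h::ab_group_add"
  assumes P: "\<And>x y z. x \<in> P \<Longrightarrow> y \<in> P \<Longrightarrow> z \<in> P \<Longrightarrow> x - y + z \<in> P"
    and g: "affine_hom g" and D: "affine_hom D"
    and onto: "\<And>w. \<exists>y\<in>P. g y = w"
    and zero: "\<And>y. y \<in> P \<Longrightarrow> g y = 0 \<Longrightarrow> D y = 0"
  shows "\<exists>\<Phi>. Modules.additive \<Phi> \<and> (\<forall>y\<in>P. D y = \<Phi> (g y))"
proof -
  obtain s where s: "\<And>w. s w \<in> P" "\<And>w. g (s w) = w"
    using onto by metis
  have eq: "D y = D y'" if "y \<in> P" "y' \<in> P" "g y = g y'" for y y'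
  proof -
    have "D (y - y' + s 0) = 0"
      using that s by (intro zero P) (auto simp: affine_homD[OF g])
    then show ?thesis
      using zero[of "s 0"] s by (simp add: affine_homD[OF D])
  qed
  have "D (s (w + w')) = D (s w) + D (s w')" for w w'
  proof -
    have "D (s (w + w')) = D (s w - s 0 + s w')"
      using s by (intro eq P) (auto simp: affine_homD[OF g])
    then show ?thesis
      using zero[of "s 0"] s by (simp add: affine_homD[OF D])
  qed
  then have "Modules.additive (\<lambda>w. D (s w))"
    by (rule Modules.additive.intro)
  moreover have "D y = D (s (g y))" if "y \<in> P" for y
    using that s by (intro eq) auto
  ultimately show ?thesis by blast
qed

text \<open>The first map is treated on the common zero set of the others;
  \<open>D y - \<Phi> (g y)\<close> then vanishes on that zero set, so the induction hypothesis
  applies to it.\<close>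

lemma factor_through:
  fixes gs :: "('a::ab_group_add \<Rightarrow> 'b::ab_group_add) list" and D :: "'a \<Rightarrow> 'h::ab_group_add"
  assumes "jointly_onto gs" "\<forall>g\<in>set gs. affine_hom g" "affine_hom D"
    and "\<And>y. \<forall>g\<in>set gs. g y = 0 \<Longrightarrow> D y = 0"
  shows "\<exists>\<Phi>s. length \<Phi>s = length gs \<and> (\<forall>\<Phi>\<in>set \<Phi>s. Modules.additive \<Phi>) \<and>
    (\<forall>y. D y = (\<Sum>(\<Phi>, g)\<leftarrow>zip \<Phi>s gs. \<Phi> (g y)))"
  using assms
proof (induction gs arbitrary: D)
  case Nil
  then show ?case by simp
next
  case (Cons g gs)
  have "\<exists>\<Phi>. Modules.additive \<Phi> \<and> (\<forall>y\<in>{y. \<forall>g\<in>set gs. g y = 0}. D y = \<Phi> (g y))"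
  proof (rule factor_through_one)
    show "\<exists>y\<in>{y. \<forall>g\<in>set gs. g y = 0}. g y = w" for w
    proof -
      obtain y where y: "g y = w" "map (\<lambda>g. g y) gs = replicate (length gs) 0"
        using Cons.prems(1) unfolding jointly_onto_Cons by (meson length_replicate)
      have "f y = 0" if "f \<in> set gs" for f
      proof -
        have "f y \<in> set (map (\<lambda>g. g y) gs)"
          using that by simp
        then show ?thesis
          unfolding y by (metis in_set_replicate)
      qed
      with y show ?thesis by blast
    qed
    show "x - y + z \<in> {y. \<forall>g\<in>set gs. g y = 0}"
      if "x \<in> {y. \<forall>g\<in>set gs. g y = 0}" "y \<in> {y. \<forall>g\<in>set gs. g y = 0}"
        "z \<in> {y. \<forall>g\<in>set gs. g y = 0}" for x y z
    proof clarify
      fix f assume f: "f \<in> set gs"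
      with that have "f x = 0" "f y = 0" "f z = 0"
        by blast+
      with f Cons.prems(2) show "f (x - y + z) = 0"
        by (simp add: affine_homD)
    qed
  qed (use Cons.prems in auto)
  then obtain \<Phi> where \<Phi>: "Modules.additive \<Phi>" "\<And>y. \<forall>g\<in>set gs. g y = 0 \<Longrightarrow> D y = \<Phi> (g y)"
    by blast
  have "\<exists>\<Phi>s. length \<Phi>s = length gs \<and> (\<forall>\<Phi>\<in>set \<Phi>s. Modules.additive \<Phi>) \<and>
    (\<forall>y. D y - \<Phi> (g y) = (\<Sum>(\<Phi>, g)\<leftarrow>zip \<Phi>s gs. \<Phi> (g y)))"
  proof (rule Cons.IH)
    show "jointly_onto gs"
      using Cons.prems(1) by (rule jointly_onto_tl)
    show "\<forall>g\<in>set gs. affine_hom g"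
      using Cons.prems(2) by simp
    show "affine_hom (\<lambda>y. D y - \<Phi> (g y))"
      by (rule affine_hom_diff[OF Cons.prems(3) affine_hom_additive[OF \<Phi>(1)]])
        (use Cons.prems(2) in simp)
    show "D y - \<Phi> (g y) = 0" if "\<forall>g\<in>set gs. g y = 0" for y
      using \<Phi>(2)[OF that] by simp
  qed
  then obtain \<Phi>s where "length \<Phi>s = length gs" "\<forall>\<Phi>\<in>set \<Phi>s. Modules.additive \<Phi>"
    "\<forall>y. D y - \<Phi> (g y) = (\<Sum>(\<Phi>, g)\<leftarrow>zip \<Phi>s gs. \<Phi> (g y))"
    by blast
  then have "length (\<Phi> # \<Phi>s) = length (g # gs) \<and> (\<forall>\<Phi>\<in>set (\<Phi> # \<Phi>s). Modules.additive \<Phi>) \<and>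
    (\<forall>y. D y = (\<Sum>(\<Phi>, g)\<leftarrow>zip (\<Phi> # \<Phi>s) (g # gs). \<Phi> (g y)))"
    using \<Phi>(1) by (simp add: algebra_simps)
  then show ?case by blast
qed

lemma factor_through_2:
  fixes a b :: "'a::ab_group_add \<Rightarrow> 'b::ab_group_add" and D :: "'a \<Rightarrow> 'h::ab_group_add"
  assumes "jointly_onto [a, b]" "affine_hom a" "affine_hom b" "affine_hom D"
    and "\<And>y. a y = 0 \<Longrightarrow> b y = 0 \<Longrightarrow> D y = 0"
  obtains \<Phi> \<Psi> where "Modules.additive \<Phi>" "Modules.additive \<Psi>" "\<And>y. D y = \<Phi> (a y) + \<Psi> (b y)"
  using factor_through[of "[a, b]" D] assms by (auto simp: length_Suc_conv)

lemma factor_through_3: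
  fixes a b c :: "'a::ab_group_add \<Rightarrow> 'b::ab_group_add" and D :: "'a \<Rightarrow> 'h::ab_group_add"
  assumes "jointly_onto [a, b, c]" "affine_hom a" "affine_hom b" "affine_hom c" "affine_hom D"
    and "\<And>y. a y = 0 \<Longrightarrow> b y = 0 \<Longrightarrow> c y = 0 \<Longrightarrow> D y = 0"
  obtains \<Phi> \<Psi> \<Theta> where "Modules.additive \<Phi>" "Modules.additive \<Psi>" "Modules.additive \<Theta>"
    "\<And>y. D y = \<Phi> (a y) + \<Psi> (b y) + \<Theta> (c y)"
  using factor_through[of "[a, b, c]" D] assms by (auto simp: length_Suc_conv add.assoc)

text \<open>The parallelogram hypothesis makes the increment \<open>F (x + d) - F x\<close>
  independent of \<open>x\<close>. Three translates of the complement do not cover the group, so any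
  two directions have a common base point in \<open>X\<close>, and the increment is additive in
  \<open>d\<close>.\<close>

lemma extend_affine_hom:
  fixes F :: "'a::{finite,ab_group_add} \<Rightarrow> 'h::ab_group_add"
  assumes card: "3 * card (- X) < CARD('a)"
    and F: "\<And>a b c d. a \<in> X \<Longrightarrow> b \<in> X \<Longrightarrow> c \<in> X \<Longrightarrow> d \<in> X \<Longrightarrow> d = a - b + c \<Longrightarrow>
      F a - F b + F c = F d"
  shows "\<exists>L. affine_hom L \<and> (\<forall>x\<in>X. L x = F x)"
proof -
  have ex: "\<exists>x. x \<in> X \<and> x + d \<in> X \<and> x + e \<in> X" for d e
  proof (rule ccontr)
    assume "\<not> ?thesis"
    then have bad: "x \<in> - X \<or> x + d \<in> - X \<or> x + e \<in> - X" for x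
      by blast
    have "UNIV \<subseteq> - X \<union> (\<lambda>x. x - d) ` (- X) \<union> (\<lambda>x. x - e) ` (- X)"
    proof
      fix x
      have "x = (x + d) - d" "x = (x + e) - e"
        by simp_all
      with bad[of x] show "x \<in> - X \<union> (\<lambda>x. x - d) ` (- X) \<union> (\<lambda>x. x - e) ` (- X)"
        by blast
    qed
    then have "CARD('a) \<le> card (- X \<union> (\<lambda>x. x - d) ` (- X) \<union> (\<lambda>x. x - e) ` (- X))"
      by (intro card_mono) auto
    also have "\<dots> \<le> card (- X) + card ((\<lambda>x. x - d) ` (- X)) + card ((\<lambda>x. x - e) ` (- X))"
      by (meson add_mono card_Un_le le_refl le_trans)
    also have "\<dots> \<le> card (- X) + card (- X) + card (- X)"
      by (intro add_mono card_image_le) auto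
    finally show False
      using card by simp
  qed
  define s where "s d = (SOME x. x \<in> X \<and> x + d \<in> X)" for d
  have s: "s d \<in> X" "s d + d \<in> X" for d
    using someI_ex[of "\<lambda>x. x \<in> X \<and> x + d \<in> X"] ex[of d d] unfolding s_def by auto
  define N where "N d = F (s d + d) - F (s d)" for d
  have N: "N d = F (x + d) - F x" if "x \<in> X" "x + d \<in> X" for x d
  proof -
    have "F (s d + d) - F (s d) + F x = F (x + d)"
      using that s by (intro F) (auto simp: algebra_simps)
    then show ?thesis
      by (simp add: N_def algebra_simps)
  qed
  have N_add: "N (d + e) = N d + N e" for d e
  proof -
    obtain x where "x \<in> X" "x + d \<in> X" "x + (d + e) \<in> X"
      using ex by blast
    then show ?thesis
      using N[of x d] N[of x "d + e"] N[of "x + d" e] by (simp add: add.assoc)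
  qed
  interpret N: Modules.additive N
    by (rule Modules.additive.intro) (rule N_add)
  define L where "L x = F (s 0) + N (x - s 0)" for x
  have "affine_hom L"
    unfolding affine_hom_def L_def by (simp add: N.add N.diff)
  moreover have "L x = F x" if "x \<in> X" for x
    using N[of "s 0" "x - s 0"] s[of 0] that by (simp add: L_def)
  ultimately show ?thesis by blast
qed

section \<open>Extension from generic bi-affine varieties\<close>

text \<open>With \<open>q = p\<^sup>k\<close>: an exceptional set is covered by at most \<open>q\<^sup>4\<close> pieces, one for each relation
  between four maps, each of density at most \<open>q\<^bsup>-20\<^esup>\<close> by the rank assumption.\<close>

definition sparse_set :: "nat \<Rightarrow> 'a::finite set \<Rightarrow> bool"
  where "sparse_set q A \<longleftrightarrow> card A * q ^ 16 \<le> CARD('a)"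

section \<open>Avoiding a few sparse sets\<close>

lemma sparse_translate:
  fixes A :: "'a::{finite,ab_group_add} set"
  assumes "sparse_set q A"
  shows "sparse_set q {x. a + x \<in> A}"
proof -
  have "card {x. a + x \<in> A} \<le> card A"
    by (rule card_inj_on_le[where f = "(+) a"]) auto
  then have "card {x. a + x \<in> A} * q ^ 16 \<le> card A * q ^ 16"
    by simp
  with assms show ?thesis
    unfolding sparse_set_def by linarith
qed

text \<open>Ten sparse sets cover at most \<open>10 * CARD('a) / q ^ 16\<close> points, fewer than
  \<open>card S\<close>, because \<open>q ^ 15 > 10\<close>. Density \<open>1 / q\<close> is all
  that \<open>card_kernel\<close> guarantees for the sets \<open>S\<close> used later.\<close>

lemma avoid_sparse:
  fixes As :: "'a::finite set list"
  assumes sparse: "\<forall>A\<in>set As. sparse_set q A" and len: "length As \<le> 10" and q: "2 \<le> q"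
    and S: "CARD('a) \<le> card S * q"
  obtains x where "x \<in> S" "\<forall>A\<in>set As. x \<notin> A"
proof (rule ccontr)
  assume "\<not> thesis"
  with that have "S \<subseteq> \<Union> (set As)"
    by blast
  then have "card S \<le> card (\<Union> (set As))"
    by (intro card_mono) auto
  then have "card S * q ^ 16 \<le> card (\<Union> (set As)) * q ^ 16"
    by simp
  also have "\<dots> \<le> length As * CARD('a)"
    using sparse
  proof (induction As)
    case (Cons A As)
    have "card (\<Union> (set (A # As))) * q ^ 16 \<le> (card A + card (\<Union> (set As))) * q ^ 16"
      using card_Un_le[of A "\<Union> (set As)"] by simp
    with Cons show ?case
      by (simp add: sparse_set_def algebra_simps)
  qed simp
  also have "\<dots> \<le> 10 * (card S * q)"
    using len S by (rule mult_le_mono)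
  finally have "card S * q * q ^ 15 \<le> card S * q * 10"
    by (simp add: eval_nat_numeral)
  moreover have "0 < card S * q"
    using S by (metis finite_UNIV_card_ge_0 finite_code neq0_conv not_less0 le_0_eq)
  ultimately have "q ^ 15 \<le> 10"
    by simp
  moreover have "2 ^ 15 \<le> q ^ 15"
    using q by (intro power_mono) auto
  ultimately show False
    by simp
qed

text \<open>The rank hypothesis enters the extension argument only through \<open>generic\<close>.
  Three given maps suffice because at most four maps are ever prescribed at one point.\<close>

locale generic_biaffine =
  fixes \<beta> :: "'a::{finite,ab_group_add} \<Rightarrow> 'a \<Rightarrow> 'b::{finite,ab_group_add}"
  assumes affine_left: "affine_hom (\<lambda>x. \<beta> x y)" and affine_right: "affine_hom (\<beta> x)"
    and generic: "length gs \<le> 3 \<Longrightarrow> \<forall>g\<in>set gs. affine_hom g \<Longrightarrow> jointly_onto gs \<Longrightarrow>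
      sparse_set CARD('b) {x. \<not> jointly_onto (\<beta> x # gs)}"
    and nontriv: "2 \<le> CARD('b)"
begin

lemma card_kernel: "CARD('a) \<le> card {d. \<beta> d y = \<beta> 0 y} * CARD('b)"
proof -
  have fibre: "card {x. \<beta> x y = w} \<le> card {d. \<beta> d y = \<beta> 0 y}" for w
  proof (cases "\<exists>x. \<beta> x y = w")
    case True
    then obtain x0 where x0: "\<beta> x0 y = w" by blast
    have "\<beta> (x - x0) y = \<beta> 0 y" if "\<beta> x y = w" for x
      using affine_homD[OF affine_left[of y], of x x0 0] that x0 by simp
    then show ?thesis
      by (intro card_inj_on_le[where f = "\<lambda>x. x - x0"]) (auto simp: inj_on_def)
  qed simp
  have "CARD('a) = card (\<Union>w. {x. \<beta> x y = w})"
    by (rule arg_cong[where f = card]) blast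
  also have "\<dots> \<le> (\<Sum>w\<in>UNIV. card {x. \<beta> x y = w})"
    by (rule card_UN_le) simp
  also have "\<dots> \<le> (\<Sum>w\<in>(UNIV :: 'b set). card {d. \<beta> d y = \<beta> 0 y})"
    by (rule sum_mono) (rule fibre)
  finally show ?thesis
    by (simp add: mult.commute)
qed

lemma avoid:
  assumes "\<forall>A\<in>set As. sparse_set CARD('b) A" "length As \<le> 10"
  obtains x :: 'a where "\<forall>A\<in>set As. x \<notin> A"
  using avoid_sparse[OF assms nontriv, of UNIV] nontriv by auto

lemma ex_jointly_onto: "\<exists>u v w. jointly_onto [\<beta> w, \<beta> v, \<beta> u]"
proof -
  have ex: "\<exists>x. jointly_onto (\<beta> x # gs)"
    if "length gs \<le> 3" "\<forall>g\<in>set gs. affine_hom g" "jointly_onto gs" for gs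
    using avoid[of "[{x. \<not> jointly_onto (\<beta> x # gs)}]"] generic[OF that] by auto
  obtain u where "jointly_onto [\<beta> u]"
    using ex[of "[]"] jointly_onto_Nil by auto
  moreover from this obtain v where "jointly_onto [\<beta> v, \<beta> u]"
    using ex[of "[\<beta> u]"] affine_right by auto
  moreover from this obtain w where "jointly_onto [\<beta> w, \<beta> v, \<beta> u]"
    using ex[of "[\<beta> v, \<beta> u]"] affine_right by auto
  ultimately show ?thesis by blast
qed

end

text \<open>\<open>h\<close> is the direction of the shift; \<open>u\<close> and \<open>w\<close>
  are two reference points for the derivative in that direction, so that one can replace the other
  in \<open>ex_derivative\<close>.\<close>

locale affine_on_variety = generic_biaffine \<beta>
  for \<beta> :: "'a::{finite,ab_group_add} \<Rightarrow> 'a \<Rightarrow> 'b::{finite,ab_group_add}" +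
  fixes \<phi> :: "'a \<Rightarrow> 'a \<Rightarrow> 'h::ab_group_add" and h u w :: 'a
  assumes \<phi>_left: "\<exists>f. affine_hom f \<and> (\<forall>x. \<beta> x y = 0 \<longrightarrow> \<phi> x y = f x)"
    and \<phi>_right: "\<exists>f. affine_hom f \<and> (\<forall>y. \<beta> x y = 0 \<longrightarrow> \<phi> x y = f y)"
    and base: "jointly_onto [\<lambda>y. \<beta> h y - \<beta> 0 y, \<beta> u, \<beta> w]"
begin

section \<open>The shift by \<open>h\<close> and generic points\<close>

definition lam :: "'a \<Rightarrow> 'b" where "lam y = \<beta> h y - \<beta> 0 y"

definition good :: "'a \<Rightarrow> bool" where "good x \<longleftrightarrow> jointly_onto [\<beta> x, lam, \<beta> u, \<beta> w]"

lemma base': "jointly_onto [lam, \<beta> u, \<beta> w]"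
  using base unfolding lam_def[abs_def] .

lemma affine_lam: "affine_hom lam"
  unfolding lam_def[abs_def] by (intro affine_hom_diff affine_right)

lemma \<beta>_shift: "\<beta> (x + h) y = \<beta> x y + lam y"
  using affine_homD[OF affine_left[of y], of x 0 h] by (simp add: lam_def)

lemma \<beta>_combination: "\<beta> (x1 - x2 + x3) y = \<beta> x1 y - \<beta> x2 y + \<beta> x3 y"
  by (rule affine_homD[OF affine_left])

lemma \<phi>_combination:
  assumes "\<beta> x1 y = 0" "\<beta> x2 y = 0" "\<beta> x3 y = 0" "x4 = x1 - x2 + x3"
  shows "\<phi> x1 y - \<phi> x2 y + \<phi> x3 y = \<phi> x4 y"
proof -
  obtain f where f: "affine_hom f" "\<And>x. \<beta> x y = 0 \<Longrightarrow> \<phi> x y = f x"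
    using \<phi>_left by blast
  have "\<beta> x4 y = 0"
    using assms by (simp add: \<beta>_combination)
  with assms f show ?thesis
    by (simp add: affine_homD)
qed

lemma sparse_bad: "sparse_set CARD('b) {x. \<not> good x}"
  unfolding good_def by (rule generic) (use base' affine_lam affine_right in auto)

lemma good_onto_lam: "good x \<Longrightarrow> jointly_onto [\<beta> x, lam]"
  unfolding good_def jointly_onto_4 jointly_onto_2 by meson

text \<open>The function \<open>\<alpha>\<close> plays the role of \<open>\<psi> (x + h) - \<psi> x\<close> for the extension \<open>\<psi>\<close> sought; it is
  glued from the values of that difference at \<open>x = u\<close> and \<open>x = w\<close>.\<close>

lemma ex_derivative:
  "\<exists>\<alpha>. affine_hom \<alpha> \<and>
    (\<forall>x y. good x \<longrightarrow> \<beta> x y = 0 \<longrightarrow> lam y = 0 \<longrightarrow> \<phi> (x + h) y - \<phi> x y = \<alpha> y)"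
proof -
  obtain f where f: "\<And>x. affine_hom (f x)" "\<And>x y. \<beta> x y = 0 \<Longrightarrow> \<phi> x y = f x y"
    using \<phi>_right by metis
  define \<delta> where "\<delta> x y = f (x + h) y - f x y" for x y
  have \<delta>: "affine_hom (\<delta> x)" for x
    unfolding \<delta>_def[abs_def] by (intro affine_hom_diff f)
  have \<delta>_eq: "\<delta> x y = \<phi> (x + h) y - \<phi> x y" if "\<beta> x y = 0" "lam y = 0" for x y
    using that f(2) by (simp add: \<delta>_def \<beta>_shift)
  have cross: "\<delta> x y = \<delta> x' y" if "\<beta> x y = 0" "\<beta> x' y = 0" "lam y = 0" for x x' y
  proof -
    \<comment> \<open>Since \<open>lam y = 0\<close>, the shifted points stay in the fibre over
      \<open>y\<close>, and with them the whole parallelogram \<open>x\<close>, \<open>x'\<close>,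
      \<open>x' + h\<close>, \<open>x + h\<close>.\<close>
    have "\<phi> x y - \<phi> x' y + \<phi> (x' + h) y = \<phi> (x + h) y"
      using that by (intro \<phi>_combination) (auto simp: \<beta>_shift)
    with that show ?thesis
      by (simp add: \<delta>_eq algebra_simps)
  qed
  obtain \<Phi> \<Psi> \<Theta> where \<Phi>: "Modules.additive \<Phi>" "Modules.additive \<Psi>" "Modules.additive \<Theta>"
    "\<And>y. \<delta> u y - \<delta> w y = \<Phi> (lam y) + \<Psi> (\<beta> u y) + \<Theta> (\<beta> w y)"
    by (rule factor_through_3[OF base' affine_lam affine_right affine_right
          affine_hom_diff[OF \<delta>[of u] \<delta>[of w]]]) (use cross[of u _ w] in auto)
  \<comment> \<open>The splitting also gives \<open>\<alpha> y = \<delta> w y + \<Phi> (lam y) +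
    \<Theta> (\<beta> w y)\<close>, so \<open>\<alpha>\<close> agrees with \<open>\<delta> u\<close>
    where \<open>\<beta> u\<close> vanishes and with \<open>\<delta> w\<close> where
    \<open>\<beta> w\<close> and \<open>lam\<close> vanish.\<close>
  define \<alpha> where "\<alpha> y = \<delta> u y - \<Psi> (\<beta> u y)" for y
  have \<alpha>: "affine_hom \<alpha>"
    unfolding \<alpha>_def[abs_def]
    by (rule affine_hom_diff[OF \<delta> affine_hom_additive[OF \<Phi>(2) affine_right]])
  have \<alpha>_u: "\<alpha> y = \<delta> u y" if "\<beta> u y = 0" for y
    using that by (simp add: \<alpha>_def Modules.additive.zero[OF \<Phi>(2)])
  have \<alpha>_w: "\<alpha> y = \<delta> w y" if "\<beta> w y = 0" "lam y = 0" for y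
    using that \<Phi>(4)[of y]
    by (simp add: \<alpha>_def Modules.additive.zero[OF \<Phi>(1)] Modules.additive.zero[OF \<Phi>(3)] algebra_simps)
  have "\<delta> x y = \<alpha> y" if x: "good x" and y: "\<beta> x y = 0" "lam y = 0" for x y
  proof -
    have "jointly_onto [\<beta> x, \<beta> u, lam]"
      using x unfolding good_def jointly_onto_4 jointly_onto_3 by meson
    then obtain \<Phi> \<Psi> \<Theta> where \<Phi>: "Modules.additive \<Phi>" "Modules.additive \<Psi>" "Modules.additive \<Theta>"
      "\<And>y. \<delta> x y - \<alpha> y = \<Phi> (\<beta> x y) + \<Psi> (\<beta> u y) + \<Theta> (lam y)"
      by (rule factor_through_3[OF _ affine_right affine_right affine_lam
            affine_hom_diff[OF \<delta>[of x] \<alpha>]]) (use cross[of x _ u] \<alpha>_u in auto)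
    \<comment> \<open>Comparison with \<open>\<delta> u\<close> gives nothing where
      \<open>\<beta> u\<close> takes a nonzero value \<open>p\<close>; there \<open>w\<close> serves
      as the reference point instead.\<close>
    have "\<Psi> p = 0" for p
    proof -
      obtain z where z: "\<beta> x z = 0" "lam z = 0" "\<beta> u z = p" "\<beta> w z = 0"
        using x unfolding good_def jointly_onto_4 by blast
      then have "\<delta> x z = \<alpha> z"
        using cross[of x z w] \<alpha>_w[of z] by simp
      then show ?thesis
        using \<Phi>(4)[of z] z
        by (simp add: Modules.additive.zero[OF \<Phi>(1)] Modules.additive.zero[OF \<Phi>(3)])
    qed
    then show ?thesis
      using \<Phi>(4)[of y] y
      by (simp add: Modules.additive.zero[OF \<Phi>(1)] Modules.additive.zero[OF \<Phi>(3)])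
  qed
  then show ?thesis
    using \<alpha> \<delta>_eq by metis
qed

text \<open>For good \<open>x\<close> and given \<open>\<alpha>\<close> at most one
  \<open>F x\<close> fits: two choices differ by some \<open>\<Phi> \<circ> \<beta> x\<close>, which
  must vanish on \<open>\<beta> (x + h) y = 0\<close>, where \<open>\<beta> x y\<close> still takes
  every value.\<close>

definition lifts :: "('a \<Rightarrow> 'h) \<Rightarrow> ('a \<Rightarrow> 'a \<Rightarrow> 'h) \<Rightarrow> bool"
  where "lifts \<alpha> F \<longleftrightarrow> (\<forall>x. good x \<longrightarrow> affine_hom (F x) \<and>
    (\<forall>y. \<beta> x y = 0 \<longrightarrow> F x y = \<phi> x y) \<and>
    (\<forall>y. \<beta> (x + h) y = 0 \<longrightarrow> F x y + \<alpha> y = \<phi> (x + h) y))"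

text \<open>The defect \<open>f (x + h) y - f x y - \<alpha> y\<close> vanishes on the common zero
  set, so it splits into a part through \<open>\<beta> x\<close> and a part through
  \<open>\<beta> (x + h)\<close>. Adding the first part to \<open>f x\<close> changes nothing where
  \<open>\<beta> x\<close> vanishes; the second is zero where \<open>\<beta> (x + h)\<close>
  vanishes.\<close>

lemma ex_lifts: "\<exists>\<alpha> F. lifts \<alpha> F"
proof -
  obtain \<alpha> where \<alpha>: "affine_hom \<alpha>"
    "\<And>x y. good x \<Longrightarrow> \<beta> x y = 0 \<Longrightarrow> lam y = 0 \<Longrightarrow> \<phi> (x + h) y - \<phi> x y = \<alpha> y"
    using ex_derivative by blast
  obtain f where f: "\<And>x. affine_hom (f x)" "\<And>x y. \<beta> x y = 0 \<Longrightarrow> \<phi> x y = f x y"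
    using \<phi>_right by metis
  have "\<exists>g. affine_hom g \<and> (\<forall>y. \<beta> x y = 0 \<longrightarrow> g y = \<phi> x y) \<and>
    (\<forall>y. \<beta> (x + h) y = 0 \<longrightarrow> g y + \<alpha> y = \<phi> (x + h) y)" if x: "good x" for x
  proof -
    have "jointly_onto [\<beta> x, \<beta> (x + h)]"
      unfolding jointly_onto_2
    proof (intro allI)
      fix p q
      obtain y where "\<beta> x y = p" "lam y = q - p"
        using good_onto_lam[OF x] unfolding jointly_onto_2 by blast
      then show "\<exists>y. \<beta> x y = p \<and> \<beta> (x + h) y = q"
        by (auto simp: \<beta>_shift)
    qed
    moreover have "f (x + h) y - f x y - \<alpha> y = 0" if "\<beta> x y = 0" "\<beta> (x + h) y = 0" for y
      using that \<alpha>(2)[OF x, of y] f(2)[of x y] f(2)[of "x + h" y] by (simp add: \<beta>_shift)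
    ultimately obtain \<Phi> \<Psi> where \<Phi>: "Modules.additive \<Phi>" "Modules.additive \<Psi>"
      "\<And>y. f (x + h) y - f x y - \<alpha> y = \<Phi> (\<beta> x y) + \<Psi> (\<beta> (x + h) y)"
      by (rule factor_through_2[OF _ affine_right affine_right
            affine_hom_diff[OF affine_hom_diff[OF f(1)[of "x + h"] f(1)[of x]] \<alpha>(1)]]) auto
    define g where "g y = f x y + \<Phi> (\<beta> x y)" for y
    have "affine_hom g"
      unfolding g_def[abs_def]
      by (rule affine_hom_add[OF f(1) affine_hom_additive[OF \<Phi>(1) affine_right]])
    moreover have "g y = \<phi> x y" if "\<beta> x y = 0" for y
      using that f(2) by (simp add: g_def Modules.additive.zero[OF \<Phi>(1)])
    moreover have "g y + \<alpha> y = \<phi> (x + h) y" if "\<beta> (x + h) y = 0" for y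
      using that f(2)[OF that] \<Phi>(3)[of y]
      by (simp add: g_def Modules.additive.zero[OF \<Phi>(2)] algebra_simps)
    ultimately show ?thesis by blast
  qed
  then show ?thesis
    unfolding lifts_def by metis
qed

text \<open>The defect vanishes on \<open>\<beta> x1 = \<beta> x2 = \<beta> x3 = 0\<close>, and since \<open>F\<close> is compatible with the shift
  by \<open>h\<close> also on the three sets obtained by shifting two points of opposite sign.\<close>

lemma lifts_generic:
  assumes F: "lifts \<alpha> F" and onto: "jointly_onto [\<beta> x1, \<beta> x2, \<beta> x3, lam]"
    and good: "good x1" "good x2" "good x3" "good x4" and x4: "x4 = x1 - x2 + x3"
  shows "F x1 y - F x2 y + F x3 y = F x4 y"
proof -
  have aff: "affine_hom (F x)"
    and F0: "\<And>y. \<beta> x y = 0 \<Longrightarrow> F x y = \<phi> x y"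
    and F1: "\<And>y. \<beta> (x + h) y = 0 \<Longrightarrow> F x y = \<phi> (x + h) y - \<alpha> y" if "good x" for x
    using F that unfolding lifts_def by (auto simp: algebra_simps)
  note F0' = F0[OF good(1)] F0[OF good(2)] F0[OF good(3)] F0[OF good(4)]
  note F1' = F1[OF good(1)] F1[OF good(2)] F1[OF good(3)] F1[OF good(4)]
  define D where "D y = F x1 y - F x2 y + F x3 y - F x4 y" for y
  have "affine_hom D"
    unfolding D_def[abs_def] by (intro affine_hom_diff affine_hom_add aff good)
  moreover have "jointly_onto [\<beta> x1, \<beta> x2, \<beta> x3]"
    using onto unfolding jointly_onto_4 jointly_onto_3 by meson
  moreover have "D y = 0" if "\<beta> x1 y = 0" "\<beta> x2 y = 0" "\<beta> x3 y = 0" for y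
  proof -
    have "\<beta> x4 y = 0"
      using that by (simp add: x4 \<beta>_combination)
    then show ?thesis
      using that \<phi>_combination[OF that x4] by (simp add: D_def F0')
  qed
  ultimately obtain \<Phi> \<Psi> \<Theta> where \<Phi>: "Modules.additive \<Phi>" "Modules.additive \<Psi>"
    "Modules.additive \<Theta>" "\<And>y. D y = \<Phi> (\<beta> x1 y) + \<Psi> (\<beta> x2 y) + \<Theta> (\<beta> x3 y)"
    using factor_through_3[OF _ affine_right affine_right affine_right] by metis
  note zeros = Modules.additive.zero[OF \<Phi>(1)] Modules.additive.zero[OF \<Phi>(2)]
    Modules.additive.zero[OF \<Phi>(3)]
  have 1: "\<Phi> p = 0" for p
  proof -
    \<comment> \<open>Here \<open>\<beta> x4 y = p\<close> as well, so \<open>lam y = - p\<close>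
      brings both \<open>x1 + h\<close> and \<open>x4 + h\<close> into the fibre over
      \<open>y\<close>; their two copies of \<open>\<alpha>\<close> cancel in
      \<open>D\<close>.\<close>
    obtain y where y: "\<beta> x1 y = p" "\<beta> x2 y = 0" "\<beta> x3 y = 0" "lam y = - p"
      using onto unfolding jointly_onto_4 by blast
    have "\<beta> (x1 + h) y = 0" "\<beta> (x4 + h) y = 0"
      using y by (simp_all add: \<beta>_shift x4 \<beta>_combination)
    moreover have "\<phi> (x1 + h) y - \<phi> x2 y + \<phi> x3 y = \<phi> (x4 + h) y"
      using y by (intro \<phi>_combination) (simp_all add: \<beta>_shift x4)
    ultimately have "D y = 0"
      using y by (simp add: D_def F0' F1' algebra_simps)
    with \<Phi>(4)[of y] y show ?thesis
      by (simp add: zeros)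
  qed
  have 2: "\<Psi> p = 0" for p
  proof -
    obtain y where y: "\<beta> x1 y = p" "\<beta> x2 y = p" "\<beta> x3 y = 0" "lam y = - p"
      using onto unfolding jointly_onto_4 by blast
    have "\<beta> (x1 + h) y = 0" "\<beta> (x2 + h) y = 0" "\<beta> x4 y = 0"
      using y by (simp_all add: \<beta>_shift x4 \<beta>_combination)
    moreover have "\<phi> (x1 + h) y - \<phi> (x2 + h) y + \<phi> x3 y = \<phi> x4 y"
      using y by (intro \<phi>_combination) (simp_all add: \<beta>_shift x4)
    ultimately have "D y = 0"
      using y by (simp add: D_def F0' F1' algebra_simps)
    with \<Phi>(4)[of y] y show ?thesis
      by (simp add: zeros 1)
  qed
  have 3: "\<Theta> p = 0" for p
  proof -
    obtain y where y: "\<beta> x1 y = 0" "\<beta> x2 y = 0" "\<beta> x3 y = p" "lam y = - p"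
      using onto unfolding jointly_onto_4 by blast
    have "\<beta> (x3 + h) y = 0" "\<beta> (x4 + h) y = 0"
      using y by (simp_all add: \<beta>_shift x4 \<beta>_combination)
    moreover have "\<phi> x1 y - \<phi> x2 y + \<phi> (x3 + h) y = \<phi> (x4 + h) y"
      using y by (intro \<phi>_combination) (simp_all add: \<beta>_shift x4 add.assoc)
    ultimately have "D y = 0"
      using y by (simp add: D_def F0' F1' algebra_simps)
    with \<Phi>(4)[of y] y show ?thesis
      by (simp add: zeros)
  qed
  have "D y = 0"
    by (simp add: \<Phi>(4) 1 2 3)
  then show ?thesis
    by (simp add: D_def)
qed

text \<open>\<open>\<beta> a\<close>, \<open>\<beta> b\<close>, \<open>lam\<close> may be dependent,
  so the comparison goes through a generic \<open>x\<close>: by \<open>lifts_generic\<close>,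
  \<open>F (a + e) - F a\<close> and \<open>F (b + e) - F b\<close> both equal
  \<open>F (x + e) - F x\<close>. With five exceptional sets, two such lists fit the ten allowed by
  \<open>avoid\<close>.\<close>

lemma lifts_translate:
  assumes F: "lifts \<alpha> F" and good: "good a" "good b"
  shows "\<exists>As. length As \<le> 5 \<and> (\<forall>A\<in>set As. sparse_set CARD('b) A) \<and>
    (\<forall>e. (\<forall>A\<in>set As. e \<notin> A) \<longrightarrow> good (a + e) \<and> good (b + e) \<and>
      (\<forall>y. F a y - F b y = F (a + e) y - F (b + e) y))"
proof -
  have sp: "sparse_set CARD('b) {x. \<not> jointly_onto [\<beta> x, \<beta> c, lam]}" if "good c" for c
    by (rule generic) (use good_onto_lam[OF that] affine_lam affine_right in auto)
  obtain x where x: "good x" "jointly_onto [\<beta> x, \<beta> a, lam]" "jointly_onto [\<beta> x, \<beta> b, lam]"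
    using avoid[of "[{x. \<not> good x}, {x. \<not> jointly_onto [\<beta> x, \<beta> a, lam]},
      {x. \<not> jointly_onto [\<beta> x, \<beta> b, lam]}]"] sp good sparse_bad by auto
  have sp': "sparse_set CARD('b) {e. x + e \<in> {e. \<not> jointly_onto [\<beta> e, \<beta> x, \<beta> c, lam]}}"
    if "jointly_onto [\<beta> x, \<beta> c, lam]" for c
    by (rule sparse_translate, rule generic) (use that affine_lam affine_right in auto)
  define As where "As = [{e. x + e \<in> {e. \<not> jointly_onto [\<beta> e, \<beta> x, \<beta> a, lam]}},
    {e. x + e \<in> {e. \<not> jointly_onto [\<beta> e, \<beta> x, \<beta> b, lam]}},
    {e. x + e \<in> {x. \<not> good x}}, {e. a + e \<in> {x. \<not> good x}}, {e. b + e \<in> {x. \<not> good x}}]"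
  have "\<forall>A\<in>set As. sparse_set CARD('b) A"
    using sp'[OF x(2)] sp'[OF x(3)] sparse_translate[OF sparse_bad] by (simp add: As_def)
  moreover have "good (a + e) \<and> good (b + e) \<and>
    (\<forall>y. F a y - F b y = F (a + e) y - F (b + e) y)" if "\<forall>A\<in>set As. e \<notin> A" for e
  proof -
    have e: "good (x + e)" "good (a + e)" "good (b + e)"
      "jointly_onto [\<beta> (x + e), \<beta> x, \<beta> a, lam]" "jointly_onto [\<beta> (x + e), \<beta> x, \<beta> b, lam]"
      using that by (simp_all add: As_def)
    have "jointly_onto [\<beta> a, \<beta> x, \<beta> (x + e), lam]" "jointly_onto [\<beta> b, \<beta> x, \<beta> (x + e), lam]"
      using e(4,5) unfolding jointly_onto_4 by meson+
    then have "F a y - F x y + F (x + e) y = F (a + e) y"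
      "F b y - F x y + F (x + e) y = F (b + e) y" for y
      using e x good by (auto intro!: lifts_generic[OF F])
    note * = this[symmetric]
    have "F a y - F b y = F (a + e) y - F (b + e) y" for y
      by (simp only: *) simp
    with e show ?thesis by blast
  qed
  moreover have "length As \<le> 5"
    by (simp add: As_def)
  ultimately show ?thesis by blast
qed

text \<open>The pair \<open>a\<close>, \<open>b\<close> is translated by \<open>e\<close> and the
  pair \<open>d\<close>, \<open>c\<close> by \<open>b - c + e\<close>. Since
  \<open>d - c = a - b\<close>, both land on \<open>a + e\<close>, \<open>b + e\<close>, which
  removes the joint surjectivity assumed in \<open>lifts_generic\<close>.\<close>

lemma lifts_combination:
  assumes F: "lifts \<alpha> F" and good: "good a" "good b" "good c" "good d" and d: "d = a - b + c"
  shows "F a y - F b y + F c y = F d y"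
proof -
  from lifts_translate[OF F good(1,2)] obtain As where As: "length As \<le> 5"
    "\<forall>A\<in>set As. sparse_set CARD('b) A"
    "\<forall>e. (\<forall>A\<in>set As. e \<notin> A) \<longrightarrow> good (a + e) \<and> good (b + e) \<and>
      (\<forall>y. F a y - F b y = F (a + e) y - F (b + e) y)"
    by (elim exE conjE)
  from lifts_translate[OF F good(4,3)] obtain Cs where Cs: "length Cs \<le> 5"
    "\<forall>A\<in>set Cs. sparse_set CARD('b) A"
    "\<forall>e. (\<forall>A\<in>set Cs. e \<notin> A) \<longrightarrow> good (d + e) \<and> good (c + e) \<and>
      (\<forall>y. F d y - F c y = F (d + e) y - F (c + e) y)"
    by (elim exE conjE)
  obtain e where e: "\<forall>A\<in>set (As @ map (\<lambda>C. {e. (b - c) + e \<in> C}) Cs). e \<notin> A"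
  proof (rule avoid)
    show "\<forall>A\<in>set (As @ map (\<lambda>C. {e. (b - c) + e \<in> C}) Cs). sparse_set CARD('b) A"
      using As(2) Cs(2) by (auto intro: sparse_translate[where a = "b - c"])
    show "length (As @ map (\<lambda>C. {e. (b - c) + e \<in> C}) Cs) \<le> 10"
      using As(1) Cs(1) by simp
  qed
  have "F a y - F b y = F (a + e) y - F (b + e) y"
    using As(3) e by auto
  moreover have "F d y - F c y = F (d + (b - c + e)) y - F (c + (b - c + e)) y"
    using Cs(3)[rule_format, of "b - c + e"] e by auto
  moreover have "d + (b - c + e) = a + e" "c + (b - c + e) = b + e"
    by (simp_all add: d)
  ultimately have "F d y - F c y = F a y - F b y"
    by simp
  then show ?thesis
    by (simp add: algebra_simps)
qed

text \<open>This writes any \<open>x\<close>, good or not, as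
  \<open>(x + d) - (x + d + e) + (x + e)\<close> with good terms. Restricting the directions to
  \<open>S\<close> can keep the terms in a given fibre.\<close>

lemma ex_good_parallelogram:
  assumes S: "CARD('a) \<le> card S * CARD('b)"
  obtains d e where "d \<in> S" "e \<in> S" "good (x + d)" "good (x + e)" "good (x + d + e)"
proof -
  have sp: "sparse_set CARD('b) {e. a + e \<in> {x. \<not> good x}}" for a
    by (rule sparse_translate[OF sparse_bad])
  obtain d where d: "d \<in> S" "good (x + d)"
    using avoid_sparse[OF _ _ nontriv S, of "[{e. x + e \<in> {x. \<not> good x}}]"] sp by auto
  obtain e where "e \<in> S" "good (x + e)" "good (x + d + e)"
    using avoid_sparse[OF _ _ nontriv S,
        of "[{e. x + e \<in> {x. \<not> good x}}, {e. x + d + e \<in> {x. \<not> good x}}]"] sp by auto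
  with d that show thesis by blast
qed

lemma ex_biaffine_extension:
  "\<exists>\<psi>. (\<forall>x. affine_hom (\<psi> x)) \<and> (\<forall>y. affine_hom (\<lambda>x. \<psi> x y)) \<and>
    (\<forall>x y. \<beta> x y = 0 \<longrightarrow> \<psi> x y = \<phi> x y)"
proof -
  obtain \<alpha> F where F: "lifts \<alpha> F"
    using ex_lifts by blast
  have card: "3 * card (- {x. good x}) < CARD('a)"
  proof -
    have "(65536::nat) \<le> CARD('b) ^ 16"
      using power_mono[OF nontriv, of 16] by simp
    then have "card {x. \<not> good x} * 65536 \<le> CARD('a)"
      using sparse_bad unfolding sparse_set_def by (meson le_trans mult_le_mono2)
    moreover have "0 < CARD('a)"
      by (simp add: card_gt_0_iff)
    moreover have "- {x. good x} = {x. \<not> good x}"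
      by auto
    ultimately show ?thesis
      by (simp only:)
  qed
  have "\<exists>L. affine_hom L \<and> (\<forall>x\<in>{x. good x}. L x = F x y)" for y
    by (rule extend_affine_hom[OF card]) (auto intro!: lifts_combination[OF F])
  then obtain L where L: "\<And>y. affine_hom (L y)" "\<And>x y. good x \<Longrightarrow> L y x = F x y"
    by (metis mem_Collect_eq)
  have parallelogram: "L y x = F (x + d) y - F (x + d + e) y + F (x + e) y"
    if "good (x + d)" "good (x + e)" "good (x + d + e)" for x y d e
  proof -
    have "L y (x + d) - L y (x + d + e) + L y (x + e) = L y x"
      by (rule affine_hom_eqI[OF L(1)]) simp
    with that L(2) show ?thesis
      by simp
  qed
  have "affine_hom (\<lambda>y. L y x)" for x
  proof -
    \<comment> \<open>\<open>d\<close> and \<open>e\<close> are chosen independently of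
      \<open>y\<close>, so one formula expresses \<open>L y x\<close> through three affine functions
      of \<open>y\<close>.\<close>
    obtain d e where *: "good (x + d)" "good (x + e)" "good (x + d + e)"
      using ex_good_parallelogram[of UNIV x] nontriv by auto
    then have "affine_hom (F (x + d))" "affine_hom (F (x + e))" "affine_hom (F (x + d + e))"
      using F unfolding lifts_def by blast+
    then show ?thesis
      unfolding parallelogram[OF *] by (intro affine_hom_add affine_hom_diff)
  qed
  moreover have "L y x = \<phi> x y" if xy: "\<beta> x y = 0" for x y
  proof -
    \<comment> \<open>Directions from the kernel at \<open>y\<close> keep all corners in the fibre
      over \<open>y\<close>, where \<open>F\<close> agrees with \<open>\<phi>\<close> at good
      points.\<close>
    obtain d e where de: "\<beta> d y = \<beta> 0 y" "\<beta> e y = \<beta> 0 y"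
      and *: "good (x + d)" "good (x + e)" "good (x + d + e)"
      using ex_good_parallelogram[OF card_kernel[of y]] by blast
    have zero: "\<beta> (x' + d) y = 0" if "\<beta> x' y = 0" "\<beta> d y = \<beta> 0 y" for x' d
      using \<beta>_combination[of x' 0 d y] that by simp
    have "\<beta> (x + d) y = 0" "\<beta> (x + e) y = 0" "\<beta> (x + d + e) y = 0"
      using de xy by (auto intro!: zero)
    moreover from this have "\<phi> (x + d) y - \<phi> (x + d + e) y + \<phi> (x + e) y = \<phi> x y"
      by (intro \<phi>_combination) simp_all
    ultimately show ?thesis
      using F * unfolding parallelogram[OF *] lifts_def by simp
  qed
  ultimately show ?thesis
    using L(1) by (intro exI[of _ "\<lambda>x y. L y x"]) auto
qed

end

lemma (in generic_biaffine) biaffine_extension: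
  fixes \<phi> :: "'a \<Rightarrow> 'a \<Rightarrow> 'h::ab_group_add"
  assumes "\<And>y. \<exists>f. affine_hom f \<and> (\<forall>x. \<beta> x y = 0 \<longrightarrow> \<phi> x y = f x)"
    and "\<And>x. \<exists>f. affine_hom f \<and> (\<forall>y. \<beta> x y = 0 \<longrightarrow> \<phi> x y = f y)"
  shows "\<exists>\<psi>. (\<forall>x. affine_hom (\<psi> x)) \<and> (\<forall>y. affine_hom (\<lambda>x. \<psi> x y)) \<and>
    (\<forall>x y. \<beta> x y = 0 \<longrightarrow> \<psi> x y = \<phi> x y)"
proof -
  obtain u v w where onto: "jointly_onto [\<beta> w, \<beta> v, \<beta> u]"
    using ex_jointly_onto by blast
  \<comment> \<open>For \<open>h = v - u\<close> the increment is
    \<open>\<beta> v y - \<beta> u y\<close>, so this is an invertible change of the values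
    prescribed for \<open>\<beta> w\<close>, \<open>\<beta> v\<close>,
    \<open>\<beta> u\<close>.\<close>
  have "jointly_onto [\<lambda>y. \<beta> (v - u) y - \<beta> 0 y, \<beta> u, \<beta> w]"
    unfolding jointly_onto_3
  proof (intro allI)
    fix p q r
    obtain y where y: "\<beta> w y = r" "\<beta> v y = p + q" "\<beta> u y = q"
      using onto unfolding jointly_onto_3 by blast
    moreover have "\<beta> (v - u) y = \<beta> v y - \<beta> u y + \<beta> 0 y"
      using affine_homD[OF affine_left[of y], of v u 0] by simp
    ultimately show "\<exists>y. \<beta> (v - u) y - \<beta> 0 y = p \<and> \<beta> u y = q \<and> \<beta> w y = r"
      by (intro exI[of _ y]) simp
  qed
  then interpret affine_on_variety \<beta> \<phi> "v - u" u w
    by unfold_locales (use assms in auto)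
  show ?thesis
    by (rule ex_biaffine_extension)
qed

section \<open>Counting over a prime field\<close>

text \<open>In a prime field every scalar is a sum of ones.\<close>

lemma additive_scale:
  fixes f :: "'p::prime_card mod_ring ^ 'n \<Rightarrow> 'p mod_ring"
  assumes "Modules.additive f"
  shows "f (c *s x) = c * f x"
proof -
  have "f (of_nat i *s x) = of_nat i * f x" for i
    by (induction i)
      (simp_all add: vec.scale_left_distrib distrib_right Modules.additive.zero[OF assms]
        Modules.additive.add[OF assms])
  moreover obtain i where "c = of_nat i"
    using surj_of_nat_mod_ring by blast
  ultimately show ?thesis
    by simp
qed

lemma affine_map_iff_affine_hom:
  fixes f :: "'p::prime_card mod_ring ^ 'n \<Rightarrow> 'p mod_ring ^ 'm"
  shows "affine_map f \<longleftrightarrow> affine_hom f"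
proof
  assume "affine_map f"
  then obtain L c where L: "Vector_Spaces.linear (*s) (*s) L" and f: "\<And>x. f x = L x + c"
    by (auto simp: affine_map_def)
  interpret L: Vector_Spaces.linear "(*s)" "(*s)" L by fact
  show "affine_hom f"
    by (simp add: affine_hom_def f L.add L.diff)
next
  assume f: "affine_hom f"
  define L where "L x = f x - f 0" for x
  have add: "L (x + y) = L x + L y" for x y
    using affine_homD[OF f, of x 0 y] by (simp add: L_def)
  have "Modules.additive (\<lambda>x. L x $ i)" for i
    by (rule Modules.additive.intro) (simp add: add)
  then have "L (c *s x) = c *s L x" for c x
    using additive_scale by (simp add: vec_eq_iff) blast
  then have "Vector_Spaces.linear (*s) (*s) L"
    unfolding Vector_Spaces.linear_iff by (intro conjI allI vec.vector_space_axioms add)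
  then show "affine_map f"
    unfolding affine_map_def by (intro exI[of _ L] exI[of _ "f 0"]) (simp add: L_def)
qed

section \<open>Dot product, annihilators and kernels\<close>

lemma dot_commute: "dot x y = dot y x"
  by (simp add: dot_def mult.commute)

lemma dot_add_right: "dot x (y + z) = dot x y + dot x z"
  by (simp add: dot_def distrib_left sum.distrib)

lemma dot_diff_right: "dot x (y - z) = dot x y - dot x z"
  by (simp add: dot_def right_diff_distrib sum_subtractf)

lemma dot_scale_right: "dot x (c *s y) = c * dot x y"
  by (simp add: dot_def sum_distrib_left mult_ac)

lemma dot_zero_right [simp]: "dot x 0 = 0"
  by (simp add: dot_def)

lemma dot_zero_left [simp]: "dot 0 x = 0"
  by (simp add: dot_def)

lemma additive_eq_dot:
  fixes f :: "'p::prime_card mod_ring ^ 'n \<Rightarrow> 'p mod_ring"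
  assumes "Modules.additive f"
  obtains a where "\<And>x. f x = dot a x"
proof
  fix x
  have "f x = f (\<Sum>j\<in>UNIV. x $ j *s axis j 1)"
    by (simp add: basis_expansion)
  also have "\<dots> = (\<Sum>j\<in>UNIV. x $ j * f (axis j 1))"
    by (simp add: Modules.additive.sum[OF assms] additive_scale[OF assms])
  finally show "f x = dot (\<chi> j. f (axis j 1)) x"
    by (simp add: dot_def mult.commute)
qed

lemma span_of_annihilator:
  fixes s :: "'p::prime_card mod_ring ^ 'n"
  assumes "finite C" "\<And>x. \<forall>c\<in>C. dot x c = 0 \<Longrightarrow> dot x s = 0"
  shows "s \<in> vec.span C"
  using assms
proof (induction C arbitrary: s)
  case empty
  have "s $ j = 0" for j
    using empty[of "axis j 1"]
    by (simp add: dot_def axis_def if_distrib[of "\<lambda>c. c * _"] cong: if_cong)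
  then have "s = 0"
    by (simp add: vec_eq_iff)
  then show ?case
    by (simp add: vec.span_zero)
next
  case (insert c C)
  show ?case
  proof (cases "\<exists>v. (\<forall>c\<in>C. dot v c = 0) \<and> dot v c \<noteq> 0")
    case False
    then have "s \<in> vec.span C"
      using insert.prems by (intro insert.IH) auto
    then show ?thesis
      using vec.span_mono[of C "insert c C"] by blast
  next
    case True
    then obtain v where v: "\<And>c. c \<in> C \<Longrightarrow> dot v c = 0" "dot v c \<noteq> 0"
      by blast
    define a where "a = dot v s / dot v c"
    have "s - a *s c \<in> vec.span C"
    proof (rule insert.IH)
      fix x assume x: "\<forall>c\<in>C. dot x c = 0"
      define b where "b = dot x c / dot v c"
      have comb: "dot (x - b *s v) r = dot x r - b * dot v r" for b r
        by (simp add: dot_commute[of _ r] dot_diff_right dot_scale_right)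
      have "dot (x - b *s v) s = 0"
        by (rule insert.prems) (use x v in \<open>auto simp: comb b_def\<close>)
      then show "dot x (s - a *s c) = 0"
        using v(2) by (simp add: comb dot_diff_right dot_scale_right a_def b_def)
    qed
    then have "s - a *s c \<in> vec.span (insert c C)"
      using vec.span_mono[of C "insert c C"] by blast
    moreover have "a *s c \<in> vec.span (insert c C)"
      by (intro vec.span_scale vec.span_base) simp
    ultimately have "(s - a *s c) + a *s c \<in> vec.span (insert c C)"
      by (rule vec.span_add)
    then show ?thesis
      by simp
  qed
qed

text \<open>Each new independent vector \<open>c\<close> shrinks the annihilator by a factor of at
  least \<open>CARD('p)\<close>: some \<open>v\<close> annihilates \<open>C\<close> but not
  \<open>c\<close>, and the translates of the smaller annihilator by multiples of \<open>v\<close>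
  are disjoint inside the larger one.\<close>

lemma card_annihilator:
  fixes C :: "('p::prime_card mod_ring ^ 'n) set"
  assumes "finite C" "vec.independent C"
  shows "card {x. \<forall>c\<in>C. dot x c = 0} * CARD('p) ^ card C \<le> CARD('p) ^ CARD('n)"
  using assms
proof (induction C)
  case empty
  then show ?case by simp
next
  case (insert c C)
  have "c \<notin> vec.span C" "vec.independent C"
    using insert.prems insert.hyps by (simp_all add: vec.independent_insert)
  then obtain v where v: "\<And>c. c \<in> C \<Longrightarrow> dot v c = 0" "dot v c \<noteq> 0"
    using span_of_annihilator[OF insert.hyps(1), of c] by blast
  let ?f = "\<lambda>(x, b). x + b *s v"
  have comb: "dot (x + b *s v) r = dot x r + b * dot v r" for x b r
    by (simp add: dot_commute[of _ r] dot_add_right dot_scale_right)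
  have "card ({x. \<forall>c\<in>insert c C. dot x c = 0} \<times> (UNIV :: 'p mod_ring set)) \<le>
    card {x. \<forall>c\<in>C. dot x c = 0}"
  proof (rule card_inj_on_le[where f = ?f])
    show "inj_on ?f ({x. \<forall>c\<in>insert c C. dot x c = 0} \<times> UNIV)"
    proof (rule inj_onI, clarify)
      fix x b x' b'
      assume *: "\<forall>c\<in>insert c C. dot x c = 0" "\<forall>c\<in>insert c C. dot x' c = 0"
        "x + b *s v = x' + b' *s v"
      then have "dot (x + b *s v) c = dot (x' + b' *s v) c"
        by simp
      then have "b = b'"
        using *(1,2) v(2) by (simp add: comb)
      with * show "x = x' \<and> b = b'"
        by simp
    qed
  qed (use v in \<open>auto simp: comb\<close>)
  then have "card {x. \<forall>c\<in>insert c C. dot x c = 0} * CARD('p) \<le> card {x. \<forall>c\<in>C. dot x c = 0}"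
    by (simp add: card_cartesian_product)
  then have "card {x. \<forall>c\<in>insert c C. dot x c = 0} * CARD('p) * CARD('p) ^ card C \<le>
    card {x. \<forall>c\<in>C. dot x c = 0} * CARD('p) ^ card C"
    by (rule mult_le_mono1)
  also have "\<dots> \<le> CARD('p) ^ CARD('n)"
    using \<open>vec.independent C\<close> by (rule insert.IH)
  finally show ?case
    using insert.hyps by (simp add: mult.assoc)
qed

lemma card_left_kernel:
  fixes T :: "'p::prime_card mod_ring ^ 'n \<Rightarrow> 'p mod_ring ^ 'n"
  assumes "r \<le> linear_rank T"
  shows "card {x. \<forall>y. dot x (T y) = 0} * CARD('p) ^ r \<le> CARD('p) ^ CARD('n)"
proof -
  obtain C where C: "C \<subseteq> range T" "vec.independent C" "card C = vec.dim (range T)"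
    by (metis vec.basis_exists)
  have "card {x. \<forall>y. dot x (T y) = 0} \<le> card {x. \<forall>c\<in>C. dot x c = 0}"
    using C(1) by (intro card_mono) auto
  moreover have "CARD('p) ^ r \<le> CARD('p) ^ card C"
    using assms C(3) by (intro power_increasing) (auto simp: linear_rank_def Suc_le_eq card_gt_0_iff)
  ultimately have "card {x. \<forall>y. dot x (T y) = 0} * CARD('p) ^ r \<le>
    card {x. \<forall>c\<in>C. dot x c = 0} * CARD('p) ^ card C"
    by (rule mult_le_mono)
  also have "\<dots> \<le> CARD('p) ^ CARD('n)"
    by (rule card_annihilator) (use C in auto)
  finally show ?thesis .
qed

text \<open>If the increments of \<open>g\<close> on the fibre \<open>K\<close> of the other maps
  fill the space, \<open>g\<close> can be adjusted freely there. Otherwise they form a proper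
  subspace, some nonzero \<open>c\<close> annihilates it, and \<open>dot c (g y - g 0)\<close>
  vanishes wherever the increments of \<open>gs\<close> do, so it factors through them.\<close>

lemma jointly_onto_or_relation:
  fixes g :: "'a::ab_group_add \<Rightarrow> 'p::prime_card mod_ring ^ 'k"
    and gs :: "('a \<Rightarrow> 'p mod_ring ^ 'k) list"
  assumes g: "affine_hom g" and gs: "\<forall>g\<in>set gs. affine_hom g" "jointly_onto gs"
    and "\<not> jointly_onto (g # gs)"
  shows "\<exists>c cs. c \<noteq> 0 \<and> length cs = length gs \<and>
    (\<forall>y. dot c (g y - g 0) = (\<Sum>(a, g)\<leftarrow>zip cs gs. dot a (g y - g 0)))"
proof -
  define K where "K = {y. \<forall>g\<in>set gs. g y = g 0}"
  define R where "R = (\<lambda>y. g y - g 0) ` K"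
  have add: "f (x + y) = f x - f 0 + f y" if "affine_hom f" for f :: "'a \<Rightarrow> 'p mod_ring ^ 'k" and x y
    using affine_homD[OF that, of x 0 y] by simp
  have R_add: "r + r' \<in> R" if r: "r \<in> R" "r' \<in> R" for r r'
  proof -
    obtain y y' where y: "y \<in> K" "y' \<in> K" "r = g y - g 0" "r' = g y' - g 0"
      using r unfolding R_def by blast
    have "y + y' \<in> K"
      using y(1,2) gs(1) by (auto simp: K_def add)
    moreover have "r + r' = g (y + y') - g 0"
      using y(3,4) by (simp add: add[OF g])
    ultimately show ?thesis
      unfolding R_def by blast
  qed
  have R_0: "0 \<in> R"
    unfolding R_def K_def by (rule image_eqI[of _ _ 0]) auto
  have "vec.subspace R"
    unfolding vec.subspace_def
  proof (intro conjI ballI allI)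
    fix c :: "'p mod_ring" and r assume r: "r \<in> R"
    have "of_nat i *s r \<in> R" for i
      by (induction i) (use r R_0 R_add in \<open>simp_all add: vec.scale_left_distrib\<close>)
    moreover obtain i where "c = of_nat i"
      using surj_of_nat_mod_ring by blast
    ultimately show "c *s r \<in> R"
      by simp
  qed (use R_0 R_add in auto)
  have "R \<noteq> UNIV"
  proof
    assume R: "R = UNIV"
    have "jointly_onto (g # gs)"
      unfolding jointly_onto_Cons
    proof (intro allI impI)
      fix p :: "'p mod_ring ^ 'k" and ws :: "('p mod_ring ^ 'k) list"
      assume "length ws = length gs"
      then obtain y where y: "map (\<lambda>g. g y) gs = ws"
        using gs(2) unfolding jointly_onto_def by blast
      have "p - g y \<in> R"
        by (simp add: R)
      then obtain z where z: "z \<in> K" "p - g y = g z - g 0"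
        unfolding R_def by blast
      have "g (y + z) = p"
        using z(2) by (simp add: add[OF g] algebra_simps)
      moreover have "map (\<lambda>g. g (y + z)) gs = map (\<lambda>g. g y) gs"
        using z(1) gs(1) by (auto simp: K_def add)
      ultimately show "\<exists>y. g y = p \<and> map (\<lambda>g. g y) gs = ws"
        using y by metis
    qed
    with assms show False by simp
  qed
  then obtain s where "s \<notin> R"
    by blast
  then have "s \<notin> vec.span R"
    using \<open>vec.subspace R\<close> by (simp add: vec.span_eq_iff[THEN iffD2])
  then obtain c where c: "\<forall>r\<in>R. dot c r = 0" "dot c s \<noteq> 0"
    using span_of_annihilator[of R s, OF finite] by blast
  define gs' where "gs' = map (\<lambda>g y. g y - g 0) gs"
  have "\<exists>\<Phi>s. length \<Phi>s = length gs' \<and> (\<forall>\<Phi>\<in>set \<Phi>s. Modules.additive \<Phi>) \<and>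
    (\<forall>y. dot c (g y - g 0) = (\<Sum>(\<Phi>, g)\<leftarrow>zip \<Phi>s gs'. \<Phi> (g y)))"
  proof (rule factor_through)
    show "jointly_onto gs'"
      unfolding jointly_onto_def
    proof (intro allI impI)
      fix ws :: "('p mod_ring ^ 'k) list"
      assume "length ws = length gs'"
      then have len: "length (map2 (\<lambda>w g. w + g 0) ws gs) = length gs"
        by (simp add: gs'_def)
      then obtain y where "map (\<lambda>g. g y) gs = map2 (\<lambda>w g. w + g 0) ws gs"
        using gs(2) unfolding jointly_onto_def by blast
      then have "map (\<lambda>g. g y) gs' = ws"
        using \<open>length ws = length gs'\<close>
        by (auto simp: gs'_def list_eq_iff_nth_eq)
      then show "\<exists>y. map (\<lambda>g. g y) gs' = ws"
        by blast
    qed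
    show "\<forall>g\<in>set gs'. affine_hom g"
      using gs(1) by (auto simp: gs'_def intro!: affine_hom_diff affine_hom_const)
    show "affine_hom (\<lambda>y. dot c (g y - g 0))"
      using g by (simp add: affine_hom_def dot_diff_right dot_add_right)
    show "dot c (g y - g 0) = 0" if "\<forall>g\<in>set gs'. g y = 0" for y
      using that c(1) by (auto simp: gs'_def R_def K_def)
  qed
  then obtain \<Phi>s where \<Phi>s: "length \<Phi>s = length gs" "\<forall>\<Phi>\<in>set \<Phi>s. Modules.additive \<Phi>"
    "\<And>y. dot c (g y - g 0) = (\<Sum>(\<Phi>, g)\<leftarrow>zip \<Phi>s gs'. \<Phi> (g y))"
    by (auto simp: gs'_def)
  obtain a where a: "\<And>\<Phi> x. \<Phi> \<in> set \<Phi>s \<Longrightarrow> \<Phi> x = dot (a \<Phi>) x"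
    using \<Phi>s(2) additive_eq_dot by metis
  have "(\<Sum>(\<Phi>, g)\<leftarrow>zip \<Phi>s gs'. \<Phi> (g y)) = (\<Sum>(a, g)\<leftarrow>zip (map a \<Phi>s) gs. dot a (g y - g 0))" for y
    unfolding gs'_def using \<Phi>s(1) a
    by (intro arg_cong[of _ _ sum_list]) (auto simp: list_eq_iff_nth_eq)
  with \<Phi>s c(2) show ?thesis
    by (intro exI[of _ c] exI[of _ "map a \<Phi>s"]) auto
qed

text \<open>The right side of a relation does not involve \<open>x\<close>, so differences of points
  satisfying it lie in the left kernel of the \<open>c\<close>-combination of the bilinear part, of
  density at most q^(-20) for q = \<open>?q\<close>. There are at most q^4 relations, which leaves
  q^(-16).\<close>

lemma sparse_not_jointly_onto:
  fixes \<beta> :: "'p::prime_card mod_ring ^ 'n \<Rightarrow> 'p mod_ring ^ 'n \<Rightarrow> 'p mod_ring ^ 'k"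
  assumes aff: "\<And>y. affine_hom (\<lambda>x. \<beta> x y)" "\<And>x. affine_hom (\<beta> x)"
    and rank: "\<And>c. c \<noteq> 0 \<Longrightarrow>
      card {d. \<forall>y. dot c (\<beta> d y - \<beta> d 0 - \<beta> 0 y + \<beta> 0 0) = 0} * CARD('p) ^ (20 * CARD('k)) \<le>
        CARD('p) ^ CARD('n)"
    and gs: "length gs \<le> 3" "\<forall>g\<in>set gs. affine_hom g" "jointly_onto gs"
  shows "sparse_set CARD('p mod_ring ^ 'k) {x. \<not> jointly_onto (\<beta> x # gs)}"
proof -
  let ?q = "CARD('p mod_ring ^ 'k)" and ?N = "CARD('p mod_ring ^ 'n)"
  define E where "E c cs = {x. \<forall>y. dot c (\<beta> x y - \<beta> x 0) =
    (\<Sum>(a, g)\<leftarrow>zip cs gs. dot a (g y - g 0))}" for c and cs :: "('p mod_ring ^ 'k) list"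
  define I where "I = (- {0 :: 'p mod_ring ^ 'k}) \<times>
    {cs. set cs \<subseteq> (UNIV :: ('p mod_ring ^ 'k) set) \<and> length cs = length gs}"
  have "finite I"
    unfolding I_def by (intro finite_cartesian_product finite_lists_length_eq) auto
  have "card I \<le> ?q * ?q ^ length gs"
    unfolding I_def card_cartesian_product card_lists_length_eq[OF finite]
    by (intro mult_le_mono1 card_mono) auto
  also have "\<dots> \<le> ?q ^ 4"
    unfolding power_Suc[symmetric] using gs(1) by (intro power_increasing) (auto simp: Suc_le_eq)
  finally have card_I: "card I \<le> ?q ^ 4" .
  have E: "card (E c cs) * ?q ^ 20 \<le> ?N" if "c \<noteq> 0" for c cs
  proof (cases "E c cs = {}")
    case False
    then obtain x0 where x0: "x0 \<in> E c cs" by blast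
    have "dot c (\<beta> (x - x0) y - \<beta> (x - x0) 0 - \<beta> 0 y + \<beta> 0 0) = 0" if "x \<in> E c cs" for x y
    proof -
      have "\<beta> (x - x0) z = \<beta> x z - \<beta> x0 z + \<beta> 0 z" for z
        using affine_homD[OF aff(1)[of z], of x x0 0] by simp
      then have "\<beta> (x - x0) y - \<beta> (x - x0) 0 - \<beta> 0 y + \<beta> 0 0 =
        (\<beta> x y - \<beta> x 0) - (\<beta> x0 y - \<beta> x0 0)"
        by simp
      then show ?thesis
        using that x0 by (simp add: E_def dot_diff_right)
    qed
    then have "card (E c cs) \<le> card {d. \<forall>y. dot c (\<beta> d y - \<beta> d 0 - \<beta> 0 y + \<beta> 0 0) = 0}"
      by (intro card_inj_on_le[where f = "\<lambda>x. x - x0"]) (auto simp: inj_on_def)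
    then have "card (E c cs) * CARD('p) ^ (20 * CARD('k)) \<le>
      card {d. \<forall>y. dot c (\<beta> d y - \<beta> d 0 - \<beta> 0 y + \<beta> 0 0) = 0} * CARD('p) ^ (20 * CARD('k))"
      by (rule mult_le_mono1)
    also have "\<dots> \<le> ?N"
      using rank[OF that] by simp
    finally show ?thesis
      by (simp add: power_mult mult.commute[of 20])
  qed simp
  have "{x. \<not> jointly_onto (\<beta> x # gs)} \<subseteq> (\<Union>(c, cs)\<in>I. E c cs)"
    using jointly_onto_or_relation[OF aff(2) gs(2,3)] unfolding E_def I_def by fastforce
  then have "card {x. \<not> jointly_onto (\<beta> x # gs)} \<le> card (\<Union>(c, cs)\<in>I. E c cs)"
    by (intro card_mono) auto
  also have "\<dots> \<le> (\<Sum>(c, cs)\<in>I. card (E c cs))"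
    using card_UN_le[OF \<open>finite I\<close>, of "\<lambda>(c, cs). E c cs"] by (simp add: case_prod_unfold)
  finally have "card {x. \<not> jointly_onto (\<beta> x # gs)} * ?q ^ 20 \<le> (\<Sum>(c, cs)\<in>I. card (E c cs)) * ?q ^ 20"
    by (rule mult_le_mono1)
  also have "\<dots> = (\<Sum>(c, cs)\<in>I. card (E c cs) * ?q ^ 20)"
    by (simp add: sum_distrib_right case_prod_unfold)
  also have "\<dots> \<le> (\<Sum>i\<in>I. ?N)"
    by (rule sum_mono) (use E in \<open>auto simp: I_def\<close>)
  also have "\<dots> \<le> ?q ^ 4 * ?N"
    using card_I by simp
  finally have "?q ^ 4 * (card {x. \<not> jointly_onto (\<beta> x # gs)} * ?q ^ 16) \<le> ?q ^ 4 * ?N"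
    by (simp add: power_add[symmetric] mult_ac)
  then show ?thesis
    unfolding sparse_set_def by simp
qed

lemma ex_bohr_rank_witness:
  fixes B :: "(('p::prime_card mod_ring ^ 'n) \<times> ('p mod_ring ^ 'n)) set"
  assumes "bilinear_bohr_set TYPE('k::finite) B"
  obtains \<beta> :: "_ \<Rightarrow> 'p mod_ring ^ 'k" and z
  where "bi_affine \<beta>" "B = {v. \<beta> v = z}" "bi_affine_rank \<beta> = bohr_rank TYPE('k) B"
proof -
  let ?S = "{bi_affine_rank \<beta> | (\<beta> :: _ \<Rightarrow> 'p mod_ring ^ 'k) z. bi_affine \<beta> \<and> B = {v. \<beta> v = z}}"
  have "?S \<subseteq> 
    range (bi_affine_rank :: (('p mod_ring ^ 'n) \<times> ('p mod_ring ^ 'n) \<Rightarrow> 'p mod_ring ^ 'k) \<Rightarrow> nat)"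
    by blast
  then have "finite ?S"
    by (rule finite_subset) simp
  moreover have "?S \<noteq> {}"
    using assms unfolding bilinear_bohr_set_def by blast
  ultimately have "bohr_rank TYPE('k) B \<in> ?S"
    unfolding bohr_rank_def by (rule Max_in)
  with that show thesis
    by (smt (verit) mem_Collect_eq)
qed

text \<open>The mixed second difference removes all terms of \<open>\<beta>\<close> that depend on
  at most one variable and leaves \<open>dot d (Tc y)\<close>; the rank of \<open>Tc\<close> is at
  least \<open>bi_affine_rank \<beta>\<close> because \<open>c\<close> is nonzero.\<close>

lemma card_left_kernel_bi_affine:
  fixes \<beta> :: "('p::prime_card mod_ring ^ 'n) \<times> ('p mod_ring ^ 'n) \<Rightarrow> 'p mod_ring ^ 'k"
  assumes \<beta>: "bi_affine \<beta>" and r: "r \<le> bi_affine_rank \<beta>" and c: "c \<noteq> 0"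
  shows "card {d. \<forall>y. dot c (\<beta> (d, y) - \<beta> (d, 0) - \<beta> (0, y) + \<beta> (0, 0)) = 0} * CARD('p) ^ r \<le>
    CARD('p) ^ CARD('n)"
proof -
  define T where "T = bilinear_part \<beta>"
  have T: "has_bilinear_part \<beta> T"
    unfolding T_def bilinear_part_def by (rule theI'[OF ex1_bilinear_part[OF \<beta>]])
  define Tc where "Tc y = (\<Sum>i\<in>UNIV. c $ i *s T i y)" for y
  have comp: "(\<beta> (d, y) - \<beta> (d, 0) - \<beta> (0, y) + \<beta> (0, 0)) $ i = dot d (T i y)" for d y i
  proof -
    obtain a b l where "\<And>x y. \<beta> (x, y) $ i = dot x (T i y) + dot x a + dot b y + l"
      and lin: "Vector_Spaces.linear (*s) (*s) (T i)"
      using T unfolding has_bilinear_part_def by blast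
    moreover have "T i 0 = 0"
      using lin by (simp add: Vector_Spaces.linear_iff) (metis add_cancel_right_right)
    ultimately show ?thesis
      by simp
  qed
  have "dot c (\<beta> (d, y) - \<beta> (d, 0) - \<beta> (0, y) + \<beta> (0, 0)) = dot d (Tc y)" for d y
  proof -
    have sum: "dot d (\<Sum>i\<in>A. f i) = (\<Sum>i\<in>A. dot d (f i))" if "finite A" for A and f :: "'k \<Rightarrow> _"
      using that by induction (simp_all add: dot_add_right)
    have "dot d (Tc y) = (\<Sum>i\<in>UNIV. c $ i * dot d (T i y))"
      by (simp add: Tc_def sum dot_scale_right)
    then show ?thesis
      unfolding dot_def[of c] comp by simp
  qed
  moreover have "card {d. \<forall>y. dot d (Tc y) = 0} * CARD('p) ^ r \<le> CARD('p) ^ CARD('n)"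
  proof (rule card_left_kernel)
    have "bi_affine_rank \<beta> \<le> linear_rank Tc"
      unfolding bi_affine_rank_def Tc_def[abs_def] T_def
      by (rule Min_le) (use c in auto)
    with r show "r \<le> linear_rank Tc"
      by simp
  qed
  ultimately show ?thesis
    by simp
qed

theorem theorem7p7:
  fixes B :: "(('p::prime_card mod_ring ^ 'n) \<times> ('p mod_ring ^ 'n)) set"
    and \<phi> :: "('p mod_ring ^ 'n) \<times> ('p mod_ring ^ 'n) \<Rightarrow> 'p mod_ring ^ 'n"
    and t :: nat
  assumes "bilinear_bohr_set TYPE('k::finite) B"
    and "bohr_rank TYPE('k) B = t"
    and "t \<ge> 20 * CARD('k)"
    and "separately_affine_on B \<phi>"
  shows "\<exists>\<psi> :: ('p mod_ring ^ 'n) \<times> ('p mod_ring ^ 'n) \<Rightarrow> 'p mod_ring ^ 'n.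
           separately_affine_on UNIV \<psi> \<and> (\<forall>v\<in>B. \<psi> v = \<phi> v)"
proof -
  obtain \<beta> :: "_ \<Rightarrow> 'p mod_ring ^ 'k" and z
    where \<beta>: "bi_affine \<beta>" "B = {v. \<beta> v = z}" and rank: "20 * CARD('k) \<le> bi_affine_rank \<beta>"
    using ex_bohr_rank_witness[OF assms(1)] assms(2,3) by metis
  \<comment> \<open>Subtracting \<open>z\<close> makes \<open>B\<close> a zero set; the constant
    drops out of the mixed difference in the rank bound.\<close>
  define \<gamma> where "\<gamma> x y = \<beta> (x, y) - z" for x y
  have "affine_hom (\<lambda>x. \<beta> (x, y))" for y
    using \<beta>(1) unfolding separately_affine_on_def affine_map_iff_affine_hom affine_hom_def
    by (metis UNIV_I)
  then have left: "affine_hom (\<lambda>x. \<gamma> x y)" for y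
    unfolding \<gamma>_def by (intro affine_hom_diff affine_hom_const)
  have "affine_hom (\<lambda>y. \<beta> (x, y))" for x
    using \<beta>(1) unfolding separately_affine_on_def affine_map_iff_affine_hom affine_hom_def
    by (metis UNIV_I)
  then have right: "affine_hom (\<gamma> x)" for x
    unfolding \<gamma>_def[abs_def] by (intro affine_hom_diff affine_hom_const)
  have "generic_biaffine \<gamma>"
  proof
    show "sparse_set CARD('p mod_ring ^ 'k) {x. \<not> jointly_onto (\<gamma> x # gs)}"
      if "length gs \<le> 3" "\<forall>g\<in>set gs. affine_hom g" "jointly_onto gs" for gs
      using left right _ that
    proof (rule sparse_not_jointly_onto)
      show "card {d. \<forall>y. dot c (\<gamma> d y - \<gamma> d 0 - \<gamma> 0 y + \<gamma> 0 0) = 0} * CARD('p) ^ (20 * CARD('k)) \<le>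
        CARD('p) ^ CARD('n)" if "c \<noteq> 0" for c
      proof -
        have "\<gamma> d y - \<gamma> d 0 - \<gamma> 0 y + \<gamma> 0 0 =
          \<beta> (d, y) - \<beta> (d, 0) - \<beta> (0, y) + \<beta> (0, 0)" for d y
          by (simp add: \<gamma>_def)
        then show ?thesis
          using card_left_kernel_bi_affine[OF \<beta>(1) rank that] by (simp only:)
      qed
    qed
    have "2 \<le> CARD('p)"
      using prime_card[where 'a = 'p] by (rule prime_ge_2_nat)
    also have "\<dots> \<le> CARD('p) ^ CARD('k)"
      using calculation by (intro self_le_power) auto
    finally show "2 \<le> CARD('p mod_ring ^ 'k)"
      by simp
  qed (rule left right)+
  moreover have B: "(x, y) \<in> B \<longleftrightarrow> \<gamma> x y = 0" for x y
    by (simp add: \<beta>(2) \<gamma>_def)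
  ultimately obtain \<psi> where \<psi>: "\<And>x. affine_hom (\<psi> x)" "\<And>y. affine_hom (\<lambda>x. \<psi> x y)"
    "\<And>x y. \<gamma> x y = 0 \<Longrightarrow> \<psi> x y = \<phi> (x, y)"
    using generic_biaffine.biaffine_extension[of \<gamma> "\<lambda>x y. \<phi> (x, y)"] assms(4)
    unfolding separately_affine_on_def affine_map_iff_affine_hom by auto
  show ?thesis
  proof (intro exI conjI ballI)
    show "separately_affine_on UNIV (\<lambda>(x, y). \<psi> x y)"
      using \<psi>(1,2) unfolding separately_affine_on_def affine_map_iff_affine_hom by auto
    show "(case v of (x, y) \<Rightarrow> \<psi> x y) = \<phi> v" if "v \<in> B" for v
      using that \<psi>(3) by (cases v) (simp add: B)
  qed
qed

end
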